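(* Let $s \ge 1$ be an integer and let $X_s = \prod_{j=1}^s S^{2^{j-1}}$. For each $v \in \mathbb{Z}_2^s \setminus \{0\}$, let $f_v : X_s \to \mathbb{R}$ be a continuous function such that $$ f_v(Fl_j\, x) = (-1)^{v_j} f_v(x) \quad \text{for all } x \in X_s \text{ and all } j = 1, \dots, s. $$ Then there exists a point $x \in X_s$ such that $f_v(x) = 0$ for all $v \in \mathbb{Z}_2^s \setminus \{0\}$.
   Context: $S^{r}$ denotes the unit sphere in $\mathbb{R}^{r+1}$ and $\mathbb{Z}_2 = \mathbb{Z}/2\mathbb{Z}$. A point $x \in X_s$ is written $x = (x_1, \dots, x_s)$ with $x_j \in S^{2^{j-1}}$. For $j = 1,\dots,s$, the coordinate-flipping map $Fl_j : X_s \to X_s$ changes the sign of the $j$-th coordinate: $Fl_j(x_1, \dots, x_{j-1}, x_j, x_{j+1}, \dots, x_s) = (x_1, \dots, x_{j-1}, -x_j, x_{j+1}, \dots, x_s)$. For $v \in \mathbb{Z}_2^s$, $v_j$ denotes its $j$-th coordinate. *)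

theory Defs
  imports "HOL-Analysis.Analysis" "HOL-Library.Z2"
begin

text \<open>
  A point \<open>x\<close> of \<open>X_space s\<close> is a family of points \<open>x j\<close>, \<open>j \<in> {1..s}\<close> (and \<open>x j = undefined\<close>
  for other \<open>j\<close>), where \<open>x j :: nat \<Rightarrow> real\<close> lies on the unit sphere of the Euclidean space
  of dimension \<open>2 ^ (j - 1) + 1\<close>: \<^term>\<open>nsphere n\<close> is the sphere of dimension \<open>n\<close>.
\<close>

definition X_space :: "nat \<Rightarrow> (nat \<Rightarrow> nat \<Rightarrow> real) topology" where
  "X_space s = product_topology (\<lambda>j. nsphere (2 ^ (j - 1))) {1..s}"

definition Fl :: "nat \<Rightarrow> (nat \<Rightarrow> nat \<Rightarrow> real) \<Rightarrow> (nat \<Rightarrow> nat \<Rightarrow> real)" where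
  "Fl j x = x(j := (\<lambda>i. - x j i))"

lemma Fl_in_X_space:
  assumes "j \<in> {1..s}" "x \<in> topspace (X_space s)"
  shows "Fl j x \<in> topspace (X_space s)"
  using assms by (auto simp: X_space_def Fl_def nsphere PiE_iff extensional_def)

text \<open>
  The vector group with coordinates in \<^typ>\<open>bit\<close> (the integers mod 2) indexed by \<open>{1..s}\<close>;
  again the families are \<open>undefined\<close> outside the index set, so that the zero vector is unique.
\<close>

definition Z2_vecs :: "nat \<Rightarrow> (nat \<Rightarrow> bit) set" where
  "Z2_vecs s = {1..s} \<rightarrow>\<^sub>E UNIV"

definition Z2_zero :: "nat \<Rightarrow> nat \<Rightarrow> bit" where
  "Z2_zero s = (\<lambda>j\<in>{1..s}. 0)"

end

(* The cup product of the classes of the f_v in the cohomology of the quotient of X_s by the flips is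
   prod_v (sum_j v_j t_j), and t_1 t_2^2 t_3^4 ... occurs in it with coefficient 1: the factors with
   v_s = 1 are exactly as many as the exponent of t_s, and so on downwards. This is carried out with
   simplicial cochains mod 2. The hemisphere of each factor is a cube with antipodal boundary points
   identified, so the product is a grid of dimension 2^s - 1. The sign of f_v labels the grid points;
   the sum over all simplices of the product of the label changes along the i-th edge for the i-th
   vector v depends only on the behaviour of the labels under the flips, and it is 1 for a model
   labelling, for which exactly one simplex contributes. So some simplex is contained in no set where
   one f_v has constant sign, and refining the grid gives a common zero. *)
theory Submission
  imports Defs "HOL-Combinatorics.Permutations"
begin

section \<open>Involutions and sums modulo 2\<close>

text \<open>Sums and products in \<open>bit\<close> stay ring operations, so that the laws for sums
  and products over sets apply.\<close>

declare add_bit_eq_xor [simp del] mult_bit_eq_and [simp del]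

lemma bit_add_self [simp]: "x + x = (0::bit)"
  by (cases x) simp_all

lemma bit_add_eq_1_iff: "x + y = 1 \<longleftrightarrow> x \<noteq> y" for x y :: bit
  by (cases x; cases y) simp_all

text \<open>A fixed-point-free involution pairs off equal terms, and each pair adds up to 0 modulo
  2.\<close>

lemma sum_involution_bit:
  fixes F :: "'a \<Rightarrow> bit"
  assumes "finite A" "\<And>x. x \<in> A \<Longrightarrow> \<phi> x \<in> A" "\<And>x. x \<in> A \<Longrightarrow> \<phi> (\<phi> x) = x"
    "\<And>x. x \<in> A \<Longrightarrow> \<phi> x \<noteq> x" "\<And>x. x \<in> A \<Longrightarrow> F (\<phi> x) = F x"
  shows "sum F A = 0"
  using assms
proof (induction A rule: finite_psubset_induct)
  case (psubset A)
  show ?case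
  proof (cases "A = {}")
    case False
    then obtain a where a: "a \<in> A" by blast
    define B where "B = A - {a, \<phi> a}"
    have "sum F B = 0"
    proof (rule psubset.IH)
      show "B \<subset> A" using a by (auto simp: B_def)
      show "\<phi> x \<in> B" if "x \<in> B" for x
        using that psubset.prems(1,2) a unfolding B_def by (metis Diff_iff insert_iff empty_iff)
    qed (use psubset.prems in \<open>auto simp: B_def\<close>)
    moreover have "A = insert a (insert (\<phi> a) B)"
      using a psubset.prems(1) by (auto simp: B_def)
    moreover have "finite B" using psubset.hyps by (simp add: B_def)
    moreover have "a \<notin> insert (\<phi> a) B" "\<phi> a \<notin> B"
      using psubset.prems(3)[OF a] by (auto simp: B_def)
    ultimately show ?thesis
      using psubset.prems(4)[OF a] by (simp add: add.assoc[symmetric])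
  qed simp
qed

section \<open>The triangulated grid\<close>

text \<open>An integer \<open>c\<close> stands for the unit interval between \<open>c\<close> and \<open>c + 1\<close>. Edges are oriented away from
  the origin, because this orientation, unlike the increasing one, is invariant under \<open>x \<mapsto> - x\<close>.\<close>

definition near :: "int \<Rightarrow> int" where "near c = (if 0 \<le> c then c else c + 1)"
definition far :: "int \<Rightarrow> int" where "far c = (if 0 \<le> c then c + 1 else c)"
definition outward :: "int \<Rightarrow> int" where "outward c = (if 0 \<le> c then c + 1 else c - 1)"
definition inward :: "int \<Rightarrow> int" where "inward c = (if 0 \<le> c then c - 1 else c + 1)"

text \<open>The \<open>t\<close>-th vertex of the simplex of the cube \<open>e\<close> whose coordinate \<open>p\<close> moves from its near to its
  far end at time \<open>\<tau> p\<close> (Freudenthal triangulation).\<close>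

definition vert :: "(nat \<Rightarrow> int) \<Rightarrow> (nat \<Rightarrow> nat) \<Rightarrow> nat \<Rightarrow> nat \<Rightarrow> int" where
  "vert e \<tau> t = (\<lambda>p. if \<tau> p < t then far (e p) else near (e p))"

text \<open>The face map that omits vertex \<open>d\<close>. Sequences are infinite, so for an
  \<open>N\<close>-simplex only the first \<open>N\<close> entries of the result are vertices of the
  facet.\<close>

definition del :: "nat \<Rightarrow> (nat \<Rightarrow> 'a) \<Rightarrow> nat \<Rightarrow> 'a" where
  "del d u = (\<lambda>i. if i < d then u i else u (Suc i))"

locale grid =
  fixes N :: nat and m :: int and blk :: "nat \<Rightarrow> nat"
  assumes m_pos: "0 < m"
begin

definition cells :: "(nat \<Rightarrow> int) set" where
  "cells = {e. \<forall>p. (p \<in> {..<N} \<longrightarrow> e p \<in> {-m..<m}) \<and> (p \<notin> {..<N} \<longrightarrow> e p = 0)}"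

definition simplices :: "((nat \<Rightarrow> int) \<times> (nat \<Rightarrow> nat)) set" where
  "simplices = cells \<times> {\<tau>. \<tau> permutes {..<N}}"

definition flip :: "nat \<Rightarrow> (nat \<Rightarrow> int) \<Rightarrow> nat \<Rightarrow> int" where
  "flip j x = (\<lambda>p. if blk p = j then - x p else x p)"

text \<open>Antipodes are identified block by block: a point takes part in the identification for
  block \<open>j\<close> as soon as one coordinate of that block is \<plusminus> m.\<close>

definition bdry :: "nat \<Rightarrow> (nat \<Rightarrow> int) set" where
  "bdry j = {x. (\<forall>p. \<bar>x p\<bar> \<le> m) \<and> (\<exists>p<N. blk p = j \<and> \<bar>x p\<bar> = m)}"

section \<open>Cancellation of facets modulo 2\<close>

lemma finite_simplices: "finite simplices"
  unfolding simplices_def cells_def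
  by (intro finite_cartesian_product finite_set_of_finite_funs finite_permutations) auto

lemma vert_bounded: "e \<in> cells \<Longrightarrow> \<bar>vert e \<tau> t p\<bar> \<le> m"
  using m_pos by (cases "p < N") (force simp: cells_def vert_def near_def far_def)+

text \<open>The facet opposite an inner vertex \<open>d\<close> is shared by two simplices of the
  same cube, which differ in the order of the moves at times \<open>d - 1\<close> and
  \<open>d\<close>.\<close>

lemma sum_del_inner:
  fixes c :: "(nat \<Rightarrow> nat \<Rightarrow> int) \<Rightarrow> bit"
  assumes d: "0 < d" "d < N"
  shows "(\<Sum>(e, \<tau>)\<in>simplices. c (del d (vert e \<tau>))) = 0"
proof -
  let ?t = "Transposition.transpose (d - 1) d"
  have t: "?t permutes {..<N}"
    using d by (intro permutes_swap_id) auto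
  \<comment> \<open>Swapping the times \<open>d - 1\<close> and \<open>d\<close> is visible only at
    vertex \<open>d\<close>, which the facet omits.\<close>
  have lt: "?t i < k \<longleftrightarrow> i < k" if "k \<noteq> d" for i k
    using that d by (auto simp: Transposition.transpose_def)
  have "vert e (?t \<circ> \<tau>) k = vert e \<tau> k" if "k \<noteq> d" for e \<tau> k
    using lt[OF that] by (simp add: vert_def)
  then have del: "del d (vert e (?t \<circ> \<tau>)) = del d (vert e \<tau>)" for e \<tau>
    by (auto simp: del_def fun_eq_iff)
  show ?thesis
  proof (rule sum_involution_bit[where \<phi> = "\<lambda>(e, \<tau>). (e, ?t \<circ> \<tau>)"])
    fix x assume "x \<in> simplices"
    then obtain e \<tau> where x: "x = (e, \<tau>)" "e \<in> cells" "\<tau> permutes {..<N}"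
      by (auto simp: simplices_def)
    show "(case x of (e, \<tau>) \<Rightarrow> (e, ?t \<circ> \<tau>)) \<in> simplices"
      using x t permutes_compose by (auto simp: simplices_def)
    have "(?t \<circ> \<tau>) (inv \<tau> d) \<noteq> \<tau> (inv \<tau> d)"
      using d by (simp add: permutes_inverses[OF x(3)])
    then have "?t \<circ> \<tau> \<noteq> \<tau>" by metis
    then show "(case x of (e, \<tau>) \<Rightarrow> (e, ?t \<circ> \<tau>)) \<noteq> x"
      using x by auto
    show "(case (case x of (e, \<tau>) \<Rightarrow> (e, ?t \<circ> \<tau>)) of (e, \<tau>) \<Rightarrow> (e, ?t \<circ> \<tau>)) = x"
      using x by (auto simp: fun_eq_iff)
    show "(case (case x of (e, \<tau>) \<Rightarrow> (e, ?t \<circ> \<tau>)) of (e, \<tau>) \<Rightarrow> c (del d (vert e \<tau>)))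
      = (case x of (e, \<tau>) \<Rightarrow> c (del d (vert e \<tau>)))"
      using del[of e \<tau>] by (simp add: x(1))
  qed (rule finite_simplices)
qed

text \<open>Passing to the next cube outwards, the coordinate that moved first becomes the last to
  move, and every other one moves one step earlier.\<close>

definition cycle :: "nat \<Rightarrow> nat" where
  "cycle i = (if i = 0 then N - 1 else if i < N then i - 1 else i)"

definition cycle_inv :: "nat \<Rightarrow> nat" where
  "cycle_inv i = (if i = N - 1 then 0 else if i < N then i + 1 else i)"

lemma cycle_permutes: "0 < N \<Longrightarrow> cycle permutes {..<N}"
  by (rule bij_imp_permutes, rule bij_betw_byWitness[where f' = cycle_inv])
    (auto simp: cycle_def cycle_inv_def)

lemma cycle_inv_permutes: "0 < N \<Longrightarrow> cycle_inv permutes {..<N}"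
  by (rule bij_imp_permutes, rule bij_betw_byWitness[where f' = cycle])
    (auto simp: cycle_def cycle_inv_def)

text \<open>A facet opposite the first vertex is also opposite the last vertex of a simplex in the next cube
  outwards, unless it lies on the boundary of the grid; there it is matched with its antipode. A facet
  opposite the last vertex lying in a hyperplane \<open>x p = 0\<close> is matched by reflection.\<close>

lemma sum_del_outer:
  fixes c :: "(nat \<Rightarrow> nat \<Rightarrow> int) \<Rightarrow> bit"
  assumes N: "0 < N"
    and cong: "\<And>w w'. (\<And>i. i < N \<Longrightarrow> w i = w' i) \<Longrightarrow> c w = c w'"
    and inv: "\<And>w j. (\<And>i. i < N \<Longrightarrow> w i \<in> bdry j) \<Longrightarrow> c (\<lambda>i. flip j (w i)) = c w"
  shows "(\<Sum>(e, \<tau>)\<in>simplices. c (del 0 (vert e \<tau>)))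
       = (\<Sum>(e, \<tau>)\<in>simplices. c (del N (vert e \<tau>)))"
proof -
  define first where "first \<tau> = inv \<tau> 0" for \<tau> :: "nat \<Rightarrow> nat"
  define final where "final \<tau> = inv \<tau> (N - 1)" for \<tau> :: "nat \<Rightarrow> nat"
  have first: "\<tau> q = 0 \<longleftrightarrow> q = first \<tau>" "first \<tau> < N" if "\<tau> permutes {..<N}" for \<tau> q
    using that N permutes_inverses[OF that] permutes_in_image[OF permutes_inv[OF that], of 0]
    by (auto simp: first_def) metis
  have final: "\<tau> q = N - 1 \<longleftrightarrow> q = final \<tau>" "final \<tau> < N" if "\<tau> permutes {..<N}" for \<tau> q
    using that N permutes_inverses[OF that] permutes_in_image[OF permutes_inv[OF that], of "N - 1"]
    by (auto simp: final_def) metis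
  let ?S0 = "{(e, \<tau>) \<in> simplices. \<bar>far (e (first \<tau>))\<bar> = m}"
  let ?SN = "{(e, \<tau>) \<in> simplices. near (e (final \<tau>)) = 0}"
  have bd0: "(\<Sum>(e, \<tau>)\<in>?S0. c (del 0 (vert e \<tau>))) = 0"
  proof -
    \<comment> \<open>\<open>- 1 - e p\<close> stands for the mirror image of the interval of
      \<open>e p\<close>. The whole block of the first moving coordinate is reflected, because the
      identification on the boundary is the antipodal map of that block.\<close>
    define \<phi> where "\<phi> e \<tau> = (\<lambda>p. if p < N \<and> blk p = blk (first \<tau>) then - 1 - e p else e p)"
      for e :: "nat \<Rightarrow> int" and \<tau> :: "nat \<Rightarrow> nat"
    show ?thesis
    proof (rule sum_involution_bit[where \<phi> = "\<lambda>(e, \<tau>). (\<phi> e \<tau>, \<tau>)"])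
      show "finite ?S0" by (rule finite_subset[OF _ finite_simplices]) auto
      fix x assume "x \<in> ?S0"
      then obtain e \<tau> where x: "x = (e, \<tau>)" "e \<in> cells" "\<tau> permutes {..<N}"
          "\<bar>far (e (first \<tau>))\<bar> = m"
        by (auto simp: simplices_def)
      have "\<phi> e \<tau> \<in> cells" using x(2) by (force simp: cells_def \<phi>_def)
      moreover have "\<bar>far (\<phi> e \<tau> (first \<tau>))\<bar> = m"
        using x(4) first[OF x(3)] by (auto simp: \<phi>_def far_def)
      ultimately show "(case x of (e, \<tau>) \<Rightarrow> (\<phi> e \<tau>, \<tau>)) \<in> ?S0"
        using x by (auto simp: simplices_def)
      show "(case (case x of (e, \<tau>) \<Rightarrow> (\<phi> e \<tau>, \<tau>)) of (e, \<tau>) \<Rightarrow> (\<phi> e \<tau>, \<tau>)) = x"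
        using x by (auto simp: \<phi>_def)
      have "\<phi> e \<tau> (first \<tau>) \<noteq> e (first \<tau>)"
        using first[OF x(3)] by (simp add: \<phi>_def) presburger
      then show "(case x of (e, \<tau>) \<Rightarrow> (\<phi> e \<tau>, \<tau>)) \<noteq> x"
        using x by auto
      \<comment> \<open>\<open>flip\<close> also negates the coordinates from \<open>N\<close> on,
        which \<open>\<phi>\<close> keeps; they are 0 at the vertices
        \<open>i \<le> N\<close>.\<close>
      have "vert (\<phi> e \<tau>) \<tau> i = flip (blk (first \<tau>)) (vert e \<tau> i)" if "i \<le> N" for i
      proof
        fix p
        show "vert (\<phi> e \<tau>) \<tau> i p = flip (blk (first \<tau>)) (vert e \<tau> i) p"
          using x(2) that permutes_not_in[OF x(3), of p]
          by (cases "p < N") (auto simp: vert_def flip_def \<phi>_def near_def far_def cells_def)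
      qed
      then have "c (del 0 (vert (\<phi> e \<tau>) \<tau>))
          = c (\<lambda>i. flip (blk (first \<tau>)) (del 0 (vert e \<tau>) i))"
        by (intro cong) (simp add: del_def)
      \<comment> \<open>After time 0 the first moving coordinate stays at its far end, which is
        \<plusminus> m for the simplices in \<open>?S0\<close>.\<close>
      moreover have "del 0 (vert e \<tau>) i \<in> bdry (blk (first \<tau>))" for i
      proof -
        have "\<bar>vert e \<tau> (Suc i) (first \<tau>)\<bar> = m"
          using x(4) first(1)[OF x(3), of "first \<tau>"] by (simp add: vert_def)
        then show ?thesis
          unfolding bdry_def del_def using first(2)[OF x(3)] vert_bounded[OF x(2), of \<tau> "Suc i"]
          by simp blast
      qed
      ultimately have "c (del 0 (vert (\<phi> e \<tau>) \<tau>)) = c (del 0 (vert e \<tau>))"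
        using inv[of "del 0 (vert e \<tau>)" "blk (first \<tau>)"] by metis
      then show "(case (case x of (e, \<tau>) \<Rightarrow> (\<phi> e \<tau>, \<tau>)) of (e, \<tau>) \<Rightarrow> c (del 0 (vert e \<tau>)))
        = (case x of (e, \<tau>) \<Rightarrow> c (del 0 (vert e \<tau>)))"
        using x by simp
    qed
  qed
  have bdN: "(\<Sum>(e, \<tau>)\<in>?SN. c (del N (vert e \<tau>))) = 0"
  proof -
    \<comment> \<open>Only the last moving coordinate is reflected: it is 0 at all vertices before
      the omitted one, so the facet itself does not change.\<close>
    define \<phi> where "\<phi> e \<tau> = e(final \<tau> := - 1 - e (final \<tau>))"
      for e :: "nat \<Rightarrow> int" and \<tau> :: "nat \<Rightarrow> nat"
    show ?thesis
    proof (rule sum_involution_bit[where \<phi> = "\<lambda>(e, \<tau>). (\<phi> e \<tau>, \<tau>)"])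
      show "finite ?SN" by (rule finite_subset[OF _ finite_simplices]) auto
      fix x assume "x \<in> ?SN"
      then obtain e \<tau> where x: "x = (e, \<tau>)" "e \<in> cells" "\<tau> permutes {..<N}"
          "near (e (final \<tau>)) = 0"
        by (auto simp: simplices_def)
      have "\<phi> e \<tau> \<in> cells" using x(2) final[OF x(3)] by (force simp: cells_def \<phi>_def)
      moreover have "near (\<phi> e \<tau> (final \<tau>)) = 0"
        using x(4) by (auto simp: \<phi>_def near_def split: if_splits)
      ultimately show "(case x of (e, \<tau>) \<Rightarrow> (\<phi> e \<tau>, \<tau>)) \<in> ?SN"
        using x by (auto simp: simplices_def)
      show "(case (case x of (e, \<tau>) \<Rightarrow> (\<phi> e \<tau>, \<tau>)) of (e, \<tau>) \<Rightarrow> (\<phi> e \<tau>, \<tau>)) = x"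
        using x by (auto simp: \<phi>_def)
      have "\<phi> e \<tau> (final \<tau>) \<noteq> e (final \<tau>)"
        by (simp add: \<phi>_def) presburger
      then show "(case x of (e, \<tau>) \<Rightarrow> (\<phi> e \<tau>, \<tau>)) \<noteq> x"
        using x by auto
      have "vert (\<phi> e \<tau>) \<tau> i p = vert e \<tau> i p" if "i < N" for i p
      proof (cases "p = final \<tau>")
        case True
        then have "\<tau> p = N - 1" using final[OF x(3)] by simp
        then show ?thesis
          using True x(4) that by (auto simp: vert_def \<phi>_def near_def split: if_splits)
      qed (simp add: vert_def \<phi>_def)
      then have "c (del N (vert (\<phi> e \<tau>) \<tau>)) = c (del N (vert e \<tau>))"
        by (intro cong) (auto simp: del_def)
      then show "(case (case x of (e, \<tau>) \<Rightarrow> (\<phi> e \<tau>, \<tau>)) of (e, \<tau>) \<Rightarrow> c (del N (vert e \<tau>)))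
        = (case x of (e, \<tau>) \<Rightarrow> c (del N (vert e \<tau>)))"
        using x by simp
    qed
  qed
  \<comment> \<open>The cell moves outwards along the first moving coordinate and the times are
    cycled; vertex \<open>Suc i\<close> of the old simplex is then vertex \<open>i\<close> of the
    new one.\<close>
  have "(\<Sum>(e, \<tau>)\<in>simplices - ?S0. c (del 0 (vert e \<tau>)))
      = (\<Sum>(e, \<tau>)\<in>simplices - ?SN. c (del N (vert e \<tau>)))"
  proof (rule sum.reindex_bij_witness
      [where j = "\<lambda>(e, \<tau>). (e(first \<tau> := outward (e (first \<tau>))), cycle \<circ> \<tau>)"
        and i = "\<lambda>(e, \<tau>). (e(final \<tau> := inward (e (final \<tau>))), cycle_inv \<circ> \<tau>)"])
    fix x assume "x \<in> simplices - ?S0"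
    then obtain e \<tau> where x: "x = (e, \<tau>)" "e \<in> cells" "\<tau> permutes {..<N}"
        "\<bar>far (e (first \<tau>))\<bar> \<noteq> m"
      by (auto simp: simplices_def)
    let ?e = "e(first \<tau> := outward (e (first \<tau>)))" and ?\<tau> = "cycle \<circ> \<tau>"
    have p: "?\<tau> permutes {..<N}"
      using x(3) cycle_permutes[OF N] by (rule permutes_compose)
    have final_eq: "final ?\<tau> = first \<tau>"
    proof -
      have "?\<tau> (first \<tau>) = N - 1" using first(1)[OF x(3), of "first \<tau>"] by (simp add: cycle_def)
      then show ?thesis using final(1)[OF p, of "first \<tau>"] by simp
    qed
    have bnd: "- m \<le> e (first \<tau>)" "e (first \<tau>) < m"
      using x(2) first(2)[OF x(3)] by (auto simp: cells_def)
    have "outward (e (first \<tau>)) \<in> {-m..<m}"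
      using x(4) bnd by (auto simp: outward_def far_def split: if_splits)
    then have "?e \<in> cells"
      using x(2) first(2)[OF x(3)] by (simp add: cells_def)
    moreover have "near (?e (final ?\<tau>)) \<noteq> 0"
      unfolding final_eq by (auto simp: near_def outward_def)
    ultimately show "(case x of (e, \<tau>) \<Rightarrow> (e(first \<tau> := outward (e (first \<tau>))), cycle \<circ> \<tau>))
        \<in> simplices - ?SN"
      using x p by (auto simp: simplices_def)
    have "cycle_inv (cycle i) = i" for i using N by (auto simp: cycle_def cycle_inv_def)
    then have "(cycle_inv \<circ> ?\<tau>) = \<tau>" by auto
    moreover have "inward (outward (e (first \<tau>))) = e (first \<tau>)"
      by (auto simp: inward_def outward_def)
    ultimately show "(case (case x of (e, \<tau>) \<Rightarrow> (e(first \<tau> := outward (e (first \<tau>))), cycle \<circ> \<tau>))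
      of (e, \<tau>) \<Rightarrow> (e(final \<tau> := inward (e (final \<tau>))), cycle_inv \<circ> \<tau>)) = x"
      using x final_eq by auto
    have "vert ?e ?\<tau> i q = vert e \<tau> (Suc i) q" if "i < N" for i q
    proof (cases "q = first \<tau>")
      case True
      then show ?thesis
        using that first(1)[OF x(3), of q] by (auto simp: vert_def cycle_def near_def far_def outward_def)
    next
      case False
      then have "\<tau> q > 0" using first[OF x(3)] by auto
      then show ?thesis
        using False that by (auto simp: vert_def cycle_def)
    qed
    then have "c (del N (vert ?e ?\<tau>)) = c (del 0 (vert e \<tau>))"
      by (intro cong) (auto simp: del_def)
    then show "(case (case x of (e, \<tau>) \<Rightarrow> (e(first \<tau> := outward (e (first \<tau>))), cycle \<circ> \<tau>))
        of (e, \<tau>) \<Rightarrow> c (del N (vert e \<tau>))) = (case x of (e, \<tau>) \<Rightarrow> c (del 0 (vert e \<tau>)))"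
      using x by simp
  next
    fix x assume "x \<in> simplices - ?SN"
    then obtain e \<tau> where x: "x = (e, \<tau>)" "e \<in> cells" "\<tau> permutes {..<N}"
        "near (e (final \<tau>)) \<noteq> 0"
      by (auto simp: simplices_def)
    let ?e = "e(final \<tau> := inward (e (final \<tau>)))" and ?\<tau> = "cycle_inv \<circ> \<tau>"
    have p: "?\<tau> permutes {..<N}"
      using x(3) cycle_inv_permutes[OF N] by (rule permutes_compose)
    have first_eq: "first ?\<tau> = final \<tau>"
    proof -
      have "?\<tau> (final \<tau>) = 0" using final(1)[OF x(3), of "final \<tau>"] by (simp add: cycle_inv_def)
      then show ?thesis using first(1)[OF p, of "final \<tau>"] by simp
    qed
    have bnd: "- m \<le> e (final \<tau>)" "e (final \<tau>) < m"
      using x(2) final(2)[OF x(3)] by (auto simp: cells_def)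
    have "inward (e (final \<tau>)) \<in> {-m..<m}"
      using bnd by (auto simp: inward_def split: if_splits)
    then have "?e \<in> cells"
      using x(2) final(2)[OF x(3)] by (simp add: cells_def)
    moreover have "\<bar>far (?e (first ?\<tau>))\<bar> \<noteq> m"
      unfolding first_eq using bnd x(4) by (auto simp: far_def inward_def near_def split: if_splits)
    ultimately show "(case x of (e, \<tau>) \<Rightarrow> (e(final \<tau> := inward (e (final \<tau>))), cycle_inv \<circ> \<tau>))
        \<in> simplices - ?S0"
      using x p by (auto simp: simplices_def)
    have "cycle (cycle_inv i) = i" for i using N by (auto simp: cycle_def cycle_inv_def)
    then have "(cycle \<circ> ?\<tau>) = \<tau>" by auto
    moreover have "outward (inward (e (final \<tau>))) = e (final \<tau>)"
      using x(4) by (auto simp: inward_def outward_def near_def split: if_splits)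
    ultimately show "(case (case x of (e, \<tau>) \<Rightarrow> (e(final \<tau> := inward (e (final \<tau>))), cycle_inv \<circ> \<tau>))
      of (e, \<tau>) \<Rightarrow> (e(first \<tau> := outward (e (first \<tau>))), cycle \<circ> \<tau>)) = x"
      using x first_eq by auto
  qed
  moreover have "?S0 \<subseteq> simplices" "?SN \<subseteq> simplices" by auto
  note sum.subset_diff[OF this(1) finite_simplices, of "\<lambda>(e, \<tau>). c (del 0 (vert e \<tau>))"]
    sum.subset_diff[OF this(2) finite_simplices, of "\<lambda>(e, \<tau>). c (del N (vert e \<tau>))"]
  with bd0 bdN have "(\<Sum>(e, \<tau>)\<in>simplices. c (del 0 (vert e \<tau>)))
      = (\<Sum>(e, \<tau>)\<in>simplices - ?S0. c (del 0 (vert e \<tau>)))"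
    "(\<Sum>(e, \<tau>)\<in>simplices. c (del N (vert e \<tau>)))
      = (\<Sum>(e, \<tau>)\<in>simplices - ?SN. c (del N (vert e \<tau>)))"
    by (simp_all only: add_0_right)
  ultimately show ?thesis by (simp only:)
qed

text \<open>Modulo 2 the simplices form a cycle in the quotient of the grid, so every coboundary
  sums to 0. Here \<open>inv\<close> says that \<open>c\<close> descends to the quotient, and
  \<open>cong\<close> that it reads only the \<open>N\<close> vertices of a facet.\<close>

lemma sum_boundary_eq_0:
  fixes c :: "(nat \<Rightarrow> nat \<Rightarrow> int) \<Rightarrow> bit"
  assumes N: "0 < N"
    and cong: "\<And>w w'. (\<And>i. i < N \<Longrightarrow> w i = w' i) \<Longrightarrow> c w = c w'"
    and inv: "\<And>w j. (\<And>i. i < N \<Longrightarrow> w i \<in> bdry j) \<Longrightarrow> c (\<lambda>i. flip j (w i)) = c w"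
  shows "(\<Sum>(e, \<tau>)\<in>simplices. \<Sum>d\<le>N. c (del d (vert e \<tau>))) = 0"
proof -
  let ?F = "\<lambda>d. \<Sum>(e, \<tau>)\<in>simplices. c (del d (vert e \<tau>))"
  have "(\<Sum>(e, \<tau>)\<in>simplices. \<Sum>d\<le>N. c (del d (vert e \<tau>))) = (\<Sum>d\<le>N. ?F d)"
    by (subst sum.swap) (simp add: case_prod_unfold)
  also have "\<dots> = sum ?F (insert 0 (insert N {0<..<N}))"
    using N by (intro arg_cong[where f = "sum ?F"]) auto
  also have "\<dots> = ?F 0 + (?F N + sum ?F {0<..<N})"
    using N by simp
  also have "sum ?F {0<..<N} = 0" by (intro sum.neutral) (simp add: sum_del_inner)
  also have "?F 0 = ?F N" by (rule sum_del_outer; fact assms)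
  finally show ?thesis by simp
qed

end

section \<open>Products of coboundaries\<close>

text \<open>A cup product of \<open>k\<close> coboundaries of 0-cochains is a cocycle, so its values
  on the faces \<open>d \<le> k\<close> of a \<open>(k + 1)\<close>-simplex add up to its value on
  the last face.\<close>

lemma sum_prod_del_left:
  fixes g :: "nat \<Rightarrow> 'v \<Rightarrow> bit"
  shows "(\<Sum>d\<le>k. \<Prod>i<k. g i (del d u i) + g i (del d u (Suc i)))
       = (\<Prod>i<k. g i (u i) + g i (u (Suc i)))"
proof (induction k)
  case 0
  show ?case by simp
next
  case (Suc k)
  let ?P = "\<lambda>d. \<Prod>i<k. g i (del d u i) + g i (del d u (Suc i))"
  let ?Q = "\<Prod>i<k. g i (u i) + g i (u (Suc i))"
  have "(\<Sum>d\<le>k. \<Prod>i<Suc k. g i (del d u i) + g i (del d u (Suc i)))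
      = (\<Sum>d\<le>k. ?P d * (g k (u (Suc k)) + g k (u (Suc (Suc k)))))"
    by (intro sum.cong) (simp_all add: del_def)
  also have "\<dots> = ?Q * (g k (u (Suc k)) + g k (u (Suc (Suc k))))"
    unfolding sum_distrib_right[symmetric] Suc.IH ..
  finally have 1: "(\<Sum>d\<le>k. \<Prod>i<Suc k. g i (del d u i) + g i (del d u (Suc i)))
    = ?Q * (g k (u (Suc k)) + g k (u (Suc (Suc k))))" .
  have "?P (Suc k) = ?Q"
    by (intro prod.cong) (auto simp: del_def)
  then have 2: "(\<Prod>i<Suc k. g i (del (Suc k) u i) + g i (del (Suc k) u (Suc i)))
      = ?Q * (g k (u k) + g k (u (Suc (Suc k))))"
    by (simp add: del_def)
  have "a * (x + y) + a * (z + y) = a * (z + x)" for a x y z :: bit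
    by (cases a; cases x; cases y; cases z) simp_all
  then show ?case
    unfolding sum.atMost_Suc 1 2 by simp
qed

text \<open>The same cocycle property for the vertices \<open>k\<close>, ..., \<open>n\<close>,
  solved for the first face instead of the last. The factors start at \<open>Suc k\<close> while the
  vertices start at \<open>k\<close>, hence the shift to \<open>i - 1\<close>.\<close>

lemma sum_prod_del_right:
  fixes g :: "nat \<Rightarrow> 'v \<Rightarrow> bit"
  assumes "k < n"
  shows "(\<Sum>d\<in>{Suc k..n}. \<Prod>i\<in>{Suc k..<n}. g i (del d u (i - 1)) + g i (del d u i))
       = (\<Prod>i\<in>{Suc k..<n}. g i (u i) + g i (u (Suc i)))"
  using Suc_leI[OF assms]
proof (induction n rule: dec_induct)
  case base
  show ?case by simp
next
  case (step n)
  let ?e = "\<lambda>d i. g i (del d u (i - 1)) + g i (del d u i)"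
  let ?P = "\<lambda>d. \<Prod>i\<in>{Suc k..<n}. ?e d i"
  let ?\<delta> = "g n (u n) + g n (u (Suc n))"
  have P: "(\<Prod>i\<in>{Suc k..<Suc n}. ?e d i) = ?P d * ?e d n" for d
    using step.hyps by simp
  have split: "sum F {Suc k..n} = sum F {Suc k..<n} + F n" for F :: "nat \<Rightarrow> bit"
  proof -
    have "{Suc k..n} = insert n {Suc k..<n}" using step.hyps by auto
    then show ?thesis by (simp add: add.commute)
  qed
  have 1: "(\<Sum>d\<in>{Suc k..<n}. ?P d * ?e d n) = (\<Sum>d\<in>{Suc k..<n}. ?P d) * ?\<delta>"
    unfolding sum_distrib_right by (intro sum.cong) (auto simp: del_def)
  have 2: "?P (Suc n) = ?P n"
    by (intro prod.cong) (auto simp: del_def)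
  have e: "?e n n + ?e (Suc n) n = ?\<delta>"
  proof -
    have "(x + y) + (x + z) = z + y" for x y z :: bit
      by (cases x; cases y; cases z) simp_all
    then show ?thesis using step.hyps by (simp add: del_def)
  qed
  have "(\<Sum>d\<in>{Suc k..Suc n}. ?P d * ?e d n) = (\<Sum>d\<in>{Suc k..n}. ?P d * ?e d n) + ?P (Suc n) * ?e (Suc n) n"
    using step.hyps by simp
  also have "\<dots> = (\<Sum>d\<in>{Suc k..<n}. ?P d) * ?\<delta> + (?P n * ?e n n + ?P n * ?e (Suc n) n)"
    unfolding split 1 2 by (simp only: add.assoc)
  also have "\<dots> = (\<Sum>d\<in>{Suc k..n}. ?P d) * ?\<delta>"
    unfolding split distrib_left[symmetric] e distrib_right ..
  finally show ?case
    unfolding P step.IH using step.hyps by simp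
qed

context grid
begin

text \<open>
  The product is the cup product of the 1-cocycles \<open>\<delta>(g i)\<close> on the quotient; as \<open>g k\<close> itself descends
  to the quotient, it is the coboundary of the cochain \<open>c\<close> below.
\<close>

lemma sum_prod_coboundary_eq_0:
  assumes k: "k < N"
    and g: "\<And>i j x. i < N \<Longrightarrow> x \<in> bdry j \<Longrightarrow> g i (flip j x) = g i x + \<gamma> i j"
    and gk: "\<And>j. \<gamma> k j = (0::bit)"
  shows "(\<Sum>(e, \<tau>)\<in>simplices. \<Prod>i<N. g i (vert e \<tau> i) + g i (vert e \<tau> (Suc i))) = 0"
proof -
  \<comment> \<open>The cup product of the first \<open>k\<close> cocycles, the 0-cochain
    \<open>g k\<close> and the remaining cocycles. A 0-cochain uses up no edge, so the later factors
    move one vertex to the left.\<close>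
  define c where "c w = (\<Prod>i<k. g i (w i) + g i (w (Suc i))) *
    (g k (w k) * (\<Prod>i\<in>{Suc k..<N}. g i (w (i - 1)) + g i (w i)))" for w
  have "(\<Sum>d\<le>N. c (del d u)) = (\<Prod>i<N. g i (u i) + g i (u (Suc i)))" for u
  proof -
    let ?L = "\<Prod>i<k. g i (u i) + g i (u (Suc i))"
    let ?R = "\<Prod>i\<in>{Suc k..<N}. g i (u i) + g i (u (Suc i))"
    \<comment> \<open>Leibniz rule: the faces \<open>d \<le> k\<close> leave \<open>g k\<close> at
      \<open>u (Suc k)\<close>, the others leave it at \<open>u k\<close>, and the two values add up
      to the missing factor.\<close>
    have "c (del d u) = (\<Prod>i<k. g i (del d u i) + g i (del d u (Suc i))) * (g k (u (Suc k)) * ?R)"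
      if "d \<le> k" for d
    proof -
      have "(\<Prod>i\<in>{Suc k..<N}. g i (del d u (i - 1)) + g i (del d u i)) = ?R"
        using that by (intro prod.cong) (auto simp: del_def)
      moreover have "del d u k = u (Suc k)" using that by (simp add: del_def)
      ultimately show ?thesis unfolding c_def by (simp only:)
    qed
    then have "(\<Sum>d\<le>k. c (del d u)) = (\<Sum>d\<le>k.
        (\<Prod>i<k. g i (del d u i) + g i (del d u (Suc i))) * (g k (u (Suc k)) * ?R))"
      by (intro sum.cong refl) (simp only: atMost_iff)
    then have l: "(\<Sum>d\<le>k. c (del d u)) = ?L * (g k (u (Suc k)) * ?R)"
      unfolding sum_distrib_right[symmetric] sum_prod_del_left[where g = g and u = u] .
    have "c (del d u)
        = ?L * g k (u k) * (\<Prod>i\<in>{Suc k..<N}. g i (del d u (i - 1)) + g i (del d u i))"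
      if "d \<in> {Suc k..N}" for d
    proof -
      have "(\<Prod>i<k. g i (del d u i) + g i (del d u (Suc i))) = ?L"
        using that by (intro prod.cong) (auto simp: del_def)
      moreover have "del d u k = u k" using that by (simp add: del_def)
      ultimately show ?thesis unfolding c_def by (simp only: mult.assoc)
    qed
    then have "(\<Sum>d\<in>{Suc k..N}. c (del d u)) = (\<Sum>d\<in>{Suc k..N}.
        ?L * g k (u k) * (\<Prod>i\<in>{Suc k..<N}. g i (del d u (i - 1)) + g i (del d u i)))"
      by (intro sum.cong refl) (simp only:)
    then have r: "(\<Sum>d\<in>{Suc k..N}. c (del d u)) = ?L * g k (u k) * ?R"
      unfolding sum_distrib_left[symmetric] sum_prod_del_right[OF k, where g = g and u = u] .
    have N: "{..N} = {..k} \<union> {Suc k..N}" "{..<N} = insert k ({..<k} \<union> {Suc k..<N})"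
      using k by auto
    have lr: "(\<Sum>d\<le>N. c (del d u)) = (\<Sum>d\<le>k. c (del d u)) + (\<Sum>d\<in>{Suc k..N}. c (del d u))"
      unfolding N(1) by (rule sum.union_disjoint) auto
    have "{..<k} \<inter> {Suc k..<N} = {}" by auto
    then have p: "(\<Prod>i<N. g i (u i) + g i (u (Suc i)))
        = (g k (u k) + g k (u (Suc k))) * (?L * ?R)"
      unfolding N(2) by (subst prod.insert) (simp_all add: prod.union_disjoint)
    have "a * (x * b) + a * y * b = (y + x) * (a * b)" for a b x y :: bit
      by (cases a; cases b; cases x; cases y) simp_all
    then show ?thesis unfolding lr l r p .
  qed
  moreover have "(\<Sum>(e, \<tau>)\<in>simplices. \<Sum>d\<le>N. c (del d (vert e \<tau>))) = 0"
  proof (rule sum_boundary_eq_0[where c = c])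
    show "0 < N" using k by simp
    fix w w' :: "nat \<Rightarrow> nat \<Rightarrow> int" assume eq: "\<And>i. i < N \<Longrightarrow> w i = w' i"
    have "(\<Prod>i<k. g i (w i) + g i (w (Suc i))) = (\<Prod>i<k. g i (w' i) + g i (w' (Suc i)))"
      using k by (intro prod.cong) (simp_all add: eq less_imp_diff_less)
    moreover have "(\<Prod>i\<in>{Suc k..<N}. g i (w (i - 1)) + g i (w i))
        = (\<Prod>i\<in>{Suc k..<N}. g i (w' (i - 1)) + g i (w' i))"
      by (intro prod.cong) (simp_all add: eq less_imp_diff_less)
    moreover have "w k = w' k" using k by (rule eq)
    ultimately show "c w = c w'"
      unfolding c_def by (simp only:)
  next
    fix w j assume w: "\<And>i. i < N \<Longrightarrow> w i \<in> bdry j"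
    \<comment> \<open>The twist \<open>\<gamma> i j\<close> occurs at both ends of an edge and
      cancels; only the bare factor \<open>g k\<close> requires its twist to be 0.\<close>
    have \<delta>: "g i (flip j (w a)) + g i (flip j (w b)) = g i (w a) + g i (w b)"
      if "i < N" "a < N" "b < N" for i a b
    proof -
      have "(x + z) + (y + z) = x + y" for x y z :: bit
        by (cases x; cases y; cases z) simp_all
      then show ?thesis using that by (simp add: g w)
    qed
    have "(\<Prod>i<k. g i (flip j (w i)) + g i (flip j (w (Suc i))))
        = (\<Prod>i<k. g i (w i) + g i (w (Suc i)))"
      using k by (intro prod.cong) (simp_all add: \<delta> less_imp_diff_less)
    moreover have "(\<Prod>i\<in>{Suc k..<N}. g i (flip j (w (i - 1))) + g i (flip j (w i)))
        = (\<Prod>i\<in>{Suc k..<N}. g i (w (i - 1)) + g i (w i))"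
      by (intro prod.cong) (simp_all add: \<delta> less_imp_diff_less)
    moreover have "g k (flip j (w k)) = g k (w k)"
      using g[OF k w[OF k]] gk by simp
    ultimately show "c (\<lambda>i. flip j (w i)) = c w"
      unfolding c_def by (simp only:)
  qed
  ultimately show ?thesis by simp
qed

text \<open>The labels are exchanged one at a time. \<open>S k\<close> and \<open>T k\<close> have
  the same twist, so their sum is invariant under the identifications, and the change in the total
  is a sum over a coboundary.\<close>

lemma sum_prod_coboundary_cong:
  assumes S: "\<And>i j x. i < N \<Longrightarrow> x \<in> bdry j \<Longrightarrow> S i (flip j x) = S i x + \<gamma> i j"
    and T: "\<And>i j x. i < N \<Longrightarrow> x \<in> bdry j \<Longrightarrow> T i (flip j x) = T i x + (\<gamma> i j :: bit)"
  shows "(\<Sum>(e, \<tau>)\<in>simplices. \<Prod>i<N. S i (vert e \<tau> i) + S i (vert e \<tau> (Suc i)))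
       = (\<Sum>(e, \<tau>)\<in>simplices. \<Prod>i<N. T i (vert e \<tau> i) + T i (vert e \<tau> (Suc i)))"
proof -
  define W where "W k i = (if i < k then S i else T i)" for k i :: nat
  define P where "P g = (\<lambda>(e, \<tau>). \<Prod>i<N. g i (vert e \<tau> i) + g i (vert e \<tau> (Suc i)))"
    for g :: "nat \<Rightarrow> (nat \<Rightarrow> int) \<Rightarrow> bit"
  have step: "sum (P (W (Suc k))) simplices = sum (P (W k)) simplices" if k: "k < N" for k
  proof -
    define D where "D = (W k)(k := \<lambda>x. S k x + T k x)"
    have "sum (P D) simplices = 0"
      unfolding P_def
    proof (rule sum_prod_coboundary_eq_0[OF k])
      fix i j x assume "i < N" "x \<in> bdry j"
      then show "D i (flip j x) = D i x + (if i = k then 0 else \<gamma> i j)"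
      proof -
        have "(a + c) + (b + c) = a + b" for a b c :: bit
          by (cases a; cases b; cases c) simp_all
        then show ?thesis using \<open>i < N\<close> \<open>x \<in> bdry j\<close> by (simp add: D_def W_def S T)
      qed
    qed simp
    moreover have "P D = (\<lambda>y. P (W (Suc k)) y + P (W k) y)"
    proof
      fix y :: "(nat \<Rightarrow> int) \<times> (nat \<Rightarrow> nat)"
      obtain e \<tau> where y: "y = (e, \<tau>)" by (cases y)
      let ?d = "\<lambda>g i. g i (vert e \<tau> i) + g i (vert e \<tau> (Suc i)) :: bit"
      have P: "P g y = ?d g k * (\<Prod>i\<in>{..<N} - {k}. ?d g i)" for g
        unfolding y P_def prod.case using k by (intro prod.remove) auto
      have "D i = W k i" "W (Suc k) i = W k i" if "i \<noteq> k" for i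
        using that by (auto simp: D_def W_def)
      then have eq: "(\<Prod>i\<in>{..<N} - {k}. ?d D i) = (\<Prod>i\<in>{..<N} - {k}. ?d (W k) i)"
        "(\<Prod>i\<in>{..<N} - {k}. ?d (W (Suc k)) i) = (\<Prod>i\<in>{..<N} - {k}. ?d (W k) i)"
        by (intro prod.cong; simp)+
      have "?d D k = ?d (W (Suc k)) k + ?d (W k) k"
        by (simp add: D_def W_def add_ac)
      then show "P D y = P (W (Suc k)) y + P (W k) y"
        unfolding P eq by (simp only: distrib_right)
    qed
    ultimately have "sum (P (W (Suc k))) simplices + sum (P (W k)) simplices = 0"
      by (simp add: sum.distrib)
    moreover have "a = b" if "a + b = 0" for a b :: bit
      using that by (cases a; cases b) simp_all
    ultimately show ?thesis by blast
  qed
  have "sum (P (W k)) simplices = sum (P (W 0)) simplices" if "k \<le> N" for k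
    using that by (induction k) (simp_all add: step)
  from this[of N] have "sum (P (W N)) simplices = sum (P T) simplices"
    by (simp add: W_def[abs_def])
  moreover have "P (W N) = P S"
    by (auto simp: P_def W_def fun_eq_iff intro!: prod.cong)
  ultimately show ?thesis by (simp add: P_def)
qed

end

section \<open>The model labelling\<close>

context grid
begin

definition face_coords :: "nat \<Rightarrow> (nat \<Rightarrow> int) \<Rightarrow> nat set" where
  "face_coords j x = {p. p < N \<and> blk p = j \<and> \<bar>x p\<bar> = m}"

text \<open>A function on the grid that changes sign under the antipodal map of block \<open>j\<close> on the boundary:
  the sign of the last coordinate of the block that is \<open>\<plusminus> m\<close>.\<close>

definition face_sign :: "nat \<Rightarrow> (nat \<Rightarrow> int) \<Rightarrow> bit" where
  "face_sign j x = (if face_coords j x = {} then 0 else of_bool (x (Max (face_coords j x)) < 0))"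

lemma finite_face_coords [simp]: "finite (face_coords j x)"
  by (simp add: face_coords_def)

lemma face_sign_flip:
  assumes "x \<in> bdry j"
  shows "face_sign i (flip j x) = face_sign i x + of_bool (i = j)"
proof -
  have F: "face_coords i (flip j x) = face_coords i x"
    by (auto simp: face_coords_def flip_def)
  show ?thesis
  proof (cases "face_coords i x = {}")
    case True
    then have "i \<noteq> j" using assms by (auto simp: bdry_def face_coords_def)
    then show ?thesis using F True by (simp add: face_sign_def)
  next
    case False
    then have "Max (face_coords i x) \<in> face_coords i x" by simp
    then have "blk (Max (face_coords i x)) = i" "\<bar>x (Max (face_coords i x))\<bar> = m"
      by (auto simp: face_coords_def)
    then show ?thesis
      using F False m_pos by (auto simp: face_sign_def flip_def)
  qed
qed

lemma face_sign_move_other: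
  assumes "\<And>q. q \<noteq> p \<Longrightarrow> u' q = u q" "blk p \<noteq> j"
  shows "face_sign j u' = face_sign j u"
proof -
  have F: "face_coords j u' = face_coords j u"
    using assms by (auto simp: face_coords_def) metis+
  moreover have "u' (Max (face_coords j u)) = u (Max (face_coords j u))" if "face_coords j u \<noteq> {}"
  proof -
    have "Max (face_coords j u) \<in> face_coords j u" using that by simp
    then have "blk (Max (face_coords j u)) = j" by (simp add: face_coords_def)
    then show ?thesis using assms by metis
  qed
  ultimately show ?thesis by (simp add: face_sign_def)
qed

text \<open>The moving coordinate was strictly inside before, so the sign can change only if this
  coordinate arrives at \<plusminus> m and becomes the last one there.\<close>

lemma face_sign_move_same:
  assumes u': "\<And>q. q \<noteq> p \<Longrightarrow> u' q = u q" and p: "p < N" "blk p = j" "\<bar>u p\<bar> < m"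
    and neq: "face_sign j u' \<noteq> face_sign j u"
  shows "\<bar>u' p\<bar> = m" "\<And>q. q \<in> face_coords j u \<Longrightarrow> q < p" "face_sign j u' = of_bool (u' p < 0)"
proof -
  have np: "p \<notin> face_coords j u" using p by (auto simp: face_coords_def)
  have eq: "u' (Max (face_coords j u)) = u (Max (face_coords j u))" if "face_coords j u \<noteq> {}"
  proof -
    have "Max (face_coords j u) \<in> face_coords j u" using that by simp
    then show ?thesis using np u' by metis
  qed
  show m: "\<bar>u' p\<bar> = m"
  proof (rule ccontr)
    assume "\<bar>u' p\<bar> \<noteq> m"
    then have "face_coords j u' = face_coords j u"
      using p u' by (auto simp: face_coords_def) (metis less_irrefl)+
    then show False using neq eq by (simp add: face_sign_def split: if_splits)
  qed
  have F: "face_coords j u' = insert p (face_coords j u)"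
    using p m u' by (auto simp: face_coords_def) metis+
  show less: "q < p" if "q \<in> face_coords j u" for q
  proof (rule ccontr)
    assume "\<not> q < p"
    moreover have "q \<le> Max (face_coords j u)" using that by simp
    ultimately have "p \<le> Max (face_coords j u)" by simp
    then have "Max (face_coords j u') = Max (face_coords j u)"
      using that unfolding F by (subst Max_insert) (auto simp: max_absorb2)
    moreover have "face_coords j u \<noteq> {}" using that by auto
    ultimately show False using neq eq F by (simp add: face_sign_def)
  qed
  have "Max (face_coords j u') = p"
    unfolding F using less by (intro Max_eqI) (auto intro: less_imp_le)
  then show "face_sign j u' = of_bool (u' p < 0)" using F by (simp add: face_sign_def)
qed

end

text \<open>Labels and coordinates share the indices below \<open>N\<close>. \<open>V i\<close> is
  the support of the \<open>i\<close>-th vector and has maximum \<open>blk i\<close>, so as many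
  vectors have top index \<open>j\<close> as there are coordinates in block
  \<open>j\<close>.\<close>

locale labelled_grid = grid +
  fixes V :: "nat \<Rightarrow> nat set"
  assumes finite_V: "\<And>i. i < N \<Longrightarrow> finite (V i)"
    and blk_in_V: "\<And>i. i < N \<Longrightarrow> blk i \<in> V i"
    and V_le_blk: "\<And>i j. i < N \<Longrightarrow> j \<in> V i \<Longrightarrow> j \<le> blk i"
begin

text \<open>A cochain for the linear form of the \<open>i\<close>-th vector, with
  \<open>face_sign j\<close> in the place of the \<open>j\<close>-th generator.\<close>

definition model :: "nat \<Rightarrow> (nat \<Rightarrow> int) \<Rightarrow> bit" where
  "model i x = (\<Sum>j\<in>V i. face_sign j x)"

lemma model_flip:
  assumes "i < N" "x \<in> bdry j"
  shows "model i (flip j x) = model i x + of_bool (j \<in> V i)"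
  using finite_V[OF assms(1)] by (simp add: model_def face_sign_flip[OF assms(2)] sum.distrib of_bool_def)

lemma near_less: "e \<in> cells \<Longrightarrow> \<bar>near (e p)\<bar> < m"
  using m_pos by (cases "p < N") (force simp: cells_def near_def)+

lemma model_move:
  assumes "i < N" and u': "\<And>q. q \<noteq> p \<Longrightarrow> u' q = u q"
  shows "model i u' + model i u = (if blk p \<in> V i then face_sign (blk p) u' + face_sign (blk p) u else 0)"
proof -
  have "model i u' + model i u = (\<Sum>j\<in>V i. face_sign j u' + face_sign j u)"
    by (simp add: model_def sum.distrib)
  also have "\<dots> = (\<Sum>j\<in>V i. if j = blk p then face_sign j u' + face_sign j u else 0)"
    by (intro sum.cong refl) (simp add: face_sign_move_other[where u = u and u' = u' and p = p] u')
  also have "\<dots> = (if blk p \<in> V i then face_sign (blk p) u' + face_sign (blk p) u else 0)"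
    using finite_V[OF assms(1)] by (simp add: sum.delta)
  finally show ?thesis .
qed

lemma vert_Suc_other:
  assumes "\<tau> permutes {..<N}" "q \<noteq> inv \<tau> i"
  shows "vert e \<tau> (Suc i) q = vert e \<tau> i q"
proof -
  have "\<tau> q \<noteq> i" using assms permutes_inv_eq by metis
  then show ?thesis by (simp add: vert_def less_Suc_eq)
qed

section \<open>The only alternating simplex of the model labelling\<close>

definition rank :: "nat \<Rightarrow> nat \<Rightarrow> nat" where
  "rank j t = card {q. q < t \<and> blk q = j}"

lemma rank_Suc: "rank j (Suc t) = (if blk t = j then Suc (rank j t) else rank j t)"
proof -
  have "{q. q < Suc t \<and> blk q = j}
    = (if blk t = j then insert t {q. q < t \<and> blk q = j} else {q. q < t \<and> blk q = j})"
    by (auto simp: less_Suc_eq)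
  then show ?thesis by (simp add: rank_def)
qed

text \<open>Within each block the far ends are alternately \<open>- m\<close> and \<open>m\<close>,
  so that every move toggles the face sign. The first one is \<open>- m\<close> because the sign
  starts at 0.\<close>

definition model_cell :: "nat \<Rightarrow> int" where
  "model_cell t = (if t < N then if even (rank (blk t) t) then - m else m - 1 else 0)"

lemma model_cell_in_cells: "model_cell \<in> cells"
  using m_pos by (auto simp: cells_def model_cell_def)

lemma far_model_cell: "t < N \<Longrightarrow> far (model_cell t) = (if even (rank (blk t) t) then - m else m)"
  using m_pos by (simp add: model_cell_def far_def)

text \<open>Time \<open>i\<close> moves a coordinate of a block in \<open>V i\<close>, hence of number at most \<open>blk i\<close>; comparing the sums
  over all \<open>i\<close> shows that \<open>\<tau>\<close> preserves the blocks.\<close>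

lemma alternating_simplex_unique:
  assumes "(e, \<tau>) \<in> simplices"
    and alt: "\<And>i. i < N \<Longrightarrow> model i (vert e \<tau> i) + model i (vert e \<tau> (Suc i)) = 1"
  shows "\<tau> = id" "e = model_cell"
proof -
  have e: "e \<in> cells" and \<tau>: "\<tau> permutes {..<N}"
    using assms(1) by (auto simp: simplices_def)
  note inv = permutes_inverses[OF \<tau>]
  have inv_less: "inv \<tau> i < N" if "i < N" for i
    using permutes_in_image[OF permutes_inv[OF \<tau>], of i] that by simp
  have \<tau>_less: "\<tau> i < N" if "i < N" for i
    using permutes_in_image[OF \<tau>, of i] that by simp
  have blkV: "blk (inv \<tau> i) \<in> V i"
    and face_sign_neq: "face_sign (blk (inv \<tau> i)) (vert e \<tau> (Suc i)) \<noteq> face_sign (blk (inv \<tau> i)) (vert e \<tau> i)"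
    if "i < N" for i
  proof -
    have "model i (vert e \<tau> (Suc i)) + model i (vert e \<tau> i) = 1"
      using alt[OF that] by (simp add: add.commute)
    moreover note model_move[OF that, of "inv \<tau> i" "vert e \<tau> (Suc i)" "vert e \<tau> i", OF vert_Suc_other[OF \<tau>]]
    ultimately have "(if blk (inv \<tau> i) \<in> V i then face_sign (blk (inv \<tau> i)) (vert e \<tau> (Suc i))
        + face_sign (blk (inv \<tau> i)) (vert e \<tau> i) else 0) = 1"
      by simp
    then show "blk (inv \<tau> i) \<in> V i"
      "face_sign (blk (inv \<tau> i)) (vert e \<tau> (Suc i)) \<noteq> face_sign (blk (inv \<tau> i)) (vert e \<tau> i)"
      by (auto simp: bit_add_eq_1_iff split: if_splits)
  qed
  have "blk (inv \<tau> i) = blk i" if "i < N" for i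
  proof (rule sum_mono_inv[where I = "{..<N}" and f = "\<lambda>i. blk (inv \<tau> i)" and g = blk])
    show "(\<Sum>i<N. blk (inv \<tau> i)) = (\<Sum>i<N. blk i)"
      using sum.permute[OF permutes_inv[OF \<tau>], of blk] by (simp add: o_def)
    show "blk (inv \<tau> i) \<le> blk i" if "i \<in> {..<N}" for i
      using that by (intro V_le_blk blkV) auto
  qed (use that in auto)
  from this[OF \<tau>_less] have blk_\<tau>: "blk (\<tau> p) = blk p" if "p < N" for p
    using that by (simp add: inv)
  have u_at: "vert e \<tau> (\<tau> p) p = near (e p)" "vert e \<tau> (Suc (\<tau> p)) p = far (e p)" for p
    by (simp_all add: vert_def)
  have move: "\<bar>far (e p)\<bar> = m" "\<And>q. q \<in> face_coords (blk p) (vert e \<tau> (\<tau> p)) \<Longrightarrow> q < p"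
    "face_sign (blk p) (vert e \<tau> (Suc (\<tau> p))) = of_bool (far (e p) < 0)"
    "face_sign (blk p) (vert e \<tau> (Suc (\<tau> p))) \<noteq> face_sign (blk p) (vert e \<tau> (\<tau> p))" if "p < N" for p
  proof -
    have neq: "face_sign (blk p) (vert e \<tau> (Suc (\<tau> p))) \<noteq> face_sign (blk p) (vert e \<tau> (\<tau> p))"
      using face_sign_neq[OF \<tau>_less[OF that]] unfolding inv .
    have other: "vert e \<tau> (Suc (\<tau> p)) q = vert e \<tau> (\<tau> p) q" if "q \<noteq> p" for q
      by (rule vert_Suc_other[OF \<tau>]) (simp only: inv that not_False_eq_True)
    have "\<bar>vert e \<tau> (\<tau> p) p\<bar> < m" unfolding u_at by (rule near_less[OF e])
    note same = face_sign_move_same[where p = p, OF _ that refl this neq]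
    show "\<bar>far (e p)\<bar> = m" using same(1)[OF other] unfolding u_at .
    show "q < p" if "q \<in> face_coords (blk p) (vert e \<tau> (\<tau> p))" for q
      by (rule same(2)[OF other that])
    show "face_sign (blk p) (vert e \<tau> (Suc (\<tau> p))) = of_bool (far (e p) < 0)"
      using same(3)[OF other] unfolding u_at .
    show "face_sign (blk p) (vert e \<tau> (Suc (\<tau> p))) \<noteq> face_sign (blk p) (vert e \<tau> (\<tau> p))" by (fact neq)
  qed
  \<comment> \<open>At time \<open>\<tau> p\<close> the coordinate \<open>q\<close> has already
    moved to \<plusminus> m, and a sign change needs a \<open>p\<close> beyond all such
    coordinates.\<close>
  have mono: "q < p" if "p < N" "q < N" "blk q = blk p" "\<tau> q < \<tau> p" for p q
  proof (rule move(2)[OF that(1)])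
    show "q \<in> face_coords (blk p) (vert e \<tau> (\<tau> p))"
      using that move(1)[OF that(2)] by (simp add: face_coords_def vert_def)
  qed
  \<comment> \<open>A permutation that preserves the blocks and is increasing on each of them is the
    identity.\<close>
  have "\<tau> p = p" if "p < N" for p
    using that
  proof (induction p rule: less_induct)
    case (less p)
    have "\<not> \<tau> p < p"
    proof
      assume "\<tau> p < p"
      then have "\<tau> (\<tau> p) = \<tau> p" using less by simp
      then have "\<tau> p = p" using permutes_inj[OF \<tau>] by (simp add: inj_eq)
      then show False using \<open>\<tau> p < p\<close> by simp
    qed
    moreover have "\<not> p < \<tau> p"
    proof
      assume "p < \<tau> p"
      define q where "q = inv \<tau> p"
      have q: "\<tau> q = p" "q < N" using inv inv_less less.prems by (auto simp: q_def)
      then have "blk q = blk p" using blk_\<tau>[of q] by simp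
      then have "q < p" using mono[of p q] q less.prems \<open>p < \<tau> p\<close> by simp
      then have "\<tau> q = q" using less q by simp
      then show False using q \<open>q < p\<close> by simp
    qed
    ultimately show ?case by simp
  qed
  moreover have "\<tau> p = p" if "\<not> p < N" for p
    using permutes_not_in[OF \<tau>] that by simp
  ultimately show id: "\<tau> = id"
    by (intro ext) (metis id_apply)
  \<comment> \<open>Each move inside block \<open>j\<close> toggles the sign, which is 0 at vertex 0
    because near ends lie strictly inside the cube.\<close>
  have face_sign: "face_sign j (vert e \<tau> t) = of_bool (odd (rank j t))" if "t \<le> N" for t j
    using that
  proof (induction t)
    case 0
    have "face_coords j (vert e \<tau> 0) = {}"
      using near_less[OF e] by (auto simp: face_coords_def vert_def dest: less_imp_neq)
    then show ?case by (simp add: face_sign_def rank_def)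
  next
    case (Suc t)
    show ?case
    proof (cases "blk t = j")
      case True
      have "face_sign j (vert e \<tau> (Suc t)) \<noteq> face_sign j (vert e \<tau> t)"
        using move(4)[of t] Suc.prems True by (simp add: id)
      then show ?thesis using Suc True by (cases "face_sign j (vert e \<tau> (Suc t))") (auto simp: rank_Suc)
    next
      case False
      have "face_sign j (vert e \<tau> (Suc t)) = face_sign j (vert e \<tau> t)"
        using vert_Suc_other[OF \<tau>, of _ t e] False by (intro face_sign_move_other[where p = t]) (auto simp: id)
      then show ?thesis using Suc False by (simp add: rank_Suc)
    qed
  qed
  show "e = model_cell"
  proof
    fix t
    show "e t = model_cell t"
    proof (cases "t < N")
      case True
      \<comment> \<open>The parity prescribes the side to which coordinate \<open>t\<close> moves;
        as its far end is \<plusminus> m, this determines \<open>e t\<close>.\<close>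
      have "of_bool (far (e t) < 0) = (of_bool (odd (rank (blk t) (Suc t))) :: bit)"
        using move(3)[OF True] face_sign[of "Suc t" "blk t"] True by (simp add: id)
      then have "far (e t) < 0 \<longleftrightarrow> odd (rank (blk t) (Suc t))"
        by (simp only: of_bool_eq_iff)
      then have "far (e t) < 0 \<longleftrightarrow> even (rank (blk t) t)"
        by (simp add: rank_Suc)
      then show ?thesis
        using move(1)[OF True] True m_pos by (auto simp: far_def model_cell_def split: if_splits)
    next
      case False
      then show ?thesis using e by (simp add: cells_def model_cell_def)
    qed
  qed
qed

text \<open>The sign is read at the coordinate of block \<open>j\<close> that moved last; its rank
  is one less than \<open>rank j t\<close>, so an even rank there means an odd one here.\<close>

lemma face_sign_vert_model_cell:
  assumes "t \<le> N"
  shows "face_sign j (vert model_cell id t) = of_bool (odd (rank j t))"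
proof -
  have "\<bar>near (model_cell p)\<bar> \<noteq> m" for p
    using near_less[OF model_cell_in_cells, of p] by simp
  then have F: "face_coords j (vert model_cell id t) = {q. q < t \<and> blk q = j}"
    using assms far_model_cell m_pos by (auto simp: face_coords_def vert_def split: if_splits)
  show ?thesis
  proof (cases "{q. q < t \<and> blk q = j} = {}")
    case True
    then show ?thesis by (simp only: face_sign_def F rank_def) simp
  next
    case False
    define p where "p = Max {q. q < t \<and> blk q = j}"
    have fin: "finite {q. q < t \<and> blk q = j}" by simp
    have p: "p < t" "blk p = j" using Max_in[OF fin False] by (auto simp: p_def)
    have "q \<le> p" if "q < t" "blk q = j" for q
      using Max_ge[OF fin] that by (simp add: p_def)
    then have "{q. q < t \<and> blk q = j} = {q. q < Suc p \<and> blk q = j}"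
      using p by (auto simp: less_Suc_eq_le)
    then have "rank j t = Suc (rank j p)"
      using rank_Suc[of j p] p by (simp add: rank_def)
    moreover have "vert model_cell id t p = (if even (rank j p) then - m else m)"
      using p assms far_model_cell[of p] by (simp add: vert_def)
    ultimately show ?thesis
      using False m_pos by (simp add: face_sign_def F p_def[symmetric])
  qed
qed

lemma alternating_model_cell:
  assumes "i < N"
  shows "model i (vert model_cell id i) + model i (vert model_cell id (Suc i)) = 1"
proof -
  have "model i (vert model_cell id (Suc i)) + model i (vert model_cell id i)
    = face_sign (blk i) (vert model_cell id (Suc i)) + face_sign (blk i) (vert model_cell id i)"
    using model_move[OF assms, of i "vert model_cell id (Suc i)" "vert model_cell id i"] blk_in_V[OF assms]
      vert_Suc_other[OF permutes_id, of _ i model_cell] by simp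
  then show ?thesis
    using assms by (simp add: face_sign_vert_model_cell rank_Suc add.commute)
qed

lemma sum_prod_model: "(\<Sum>(e, \<tau>)\<in>simplices. \<Prod>i<N. model i (vert e \<tau> i) + model i (vert e \<tau> (Suc i))) = 1"
proof -
  have "(\<Prod>i<N. model i (vert e \<tau> i) + model i (vert e \<tau> (Suc i))) = of_bool ((e, \<tau>) = (model_cell, id))"
    if y: "(e, \<tau>) \<in> simplices" for e \<tau>
  proof (cases "(e, \<tau>) = (model_cell, id)")
    case True
    then show ?thesis using alternating_model_cell by simp
  next
    case False
    then obtain i where "i < N" "model i (vert e \<tau> i) + model i (vert e \<tau> (Suc i)) \<noteq> 1"
      using alternating_simplex_unique[OF y] by blast
    then have "(\<Prod>i<N. model i (vert e \<tau> i) + model i (vert e \<tau> (Suc i))) = 0"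
      by (intro prod_zero) auto
    with False show ?thesis by (simp only: of_bool_eq)
  qed
  then have "(\<Sum>(e, \<tau>)\<in>simplices. \<Prod>i<N. model i (vert e \<tau> i) + model i (vert e \<tau> (Suc i)))
    = (\<Sum>y\<in>simplices. if y = (model_cell, id) then 1 else 0)"
    by (intro sum.cong refl) (simp only: split_paired_all prod.case of_bool_def)
  also have "\<dots> = 1"
    using model_cell_in_cells permutes_id[of "{..<N}"] finite_simplices
    by (simp add: simplices_def)
  finally show ?thesis .
qed

text \<open>\<open>S\<close> has the twist of the model, so its sum is 1 as well. Hence some product
  is nonzero, and all its factors are.\<close>

lemma exists_alternating_simplex:
  assumes "\<And>i j x. i < N \<Longrightarrow> x \<in> bdry j \<Longrightarrow> S i (flip j x) = S i x + of_bool (j \<in> V i)"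
  obtains e \<tau> where "(e, \<tau>) \<in> simplices"
    "\<And>i. i < N \<Longrightarrow> S i (vert e \<tau> i) \<noteq> (S i (vert e \<tau> (Suc i)) :: bit)"
proof -
  have "(\<Sum>(e, \<tau>)\<in>simplices. \<Prod>i<N. S i (vert e \<tau> i) + S i (vert e \<tau> (Suc i))) = 1"
    using sum_prod_coboundary_cong[of S "\<lambda>i j. of_bool (j \<in> V i)" model] assms model_flip sum_prod_model by simp
  moreover have "(\<Sum>(e, \<tau>)\<in>simplices. \<Prod>i<N. S i (vert e \<tau> i) + S i (vert e \<tau> (Suc i))) = 0"
    if "\<And>e \<tau>. (e, \<tau>) \<in> simplices \<Longrightarrow> (\<Prod>i<N. S i (vert e \<tau> i) + S i (vert e \<tau> (Suc i))) = 0"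
    by (intro sum.neutral ballI) (simp only: split_paired_all prod.case that)
  ultimately obtain e \<tau> where y: "(e, \<tau>) \<in> simplices"
    "(\<Prod>i<N. S i (vert e \<tau> i) + S i (vert e \<tau> (Suc i))) \<noteq> 0"
    by (metis (no_types, lifting) zero_neq_one)
  have "S i (vert e \<tau> i) \<noteq> S i (vert e \<tau> (Suc i))" if "i < N" for i
  proof
    assume "S i (vert e \<tau> i) = S i (vert e \<tau> (Suc i))"
    then have "(\<Prod>i<N. S i (vert e \<tau> i) + S i (vert e \<tau> (Suc i))) = 0"
      using that by (intro prod_zero bexI[of _ i]) simp_all
    then show False using y(2) by simp
  qed
  then show ?thesis using that y(1) by blast
qed

end

section \<open>Parametrising the product of spheres\<close>

text \<open>Coordinate \<open>p < 2 ^ s - 1\<close> and label \<open>i < 2 ^ s - 1\<close> are read through the binary digits of \<open>p + 1\<close>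
  and \<open>i + 1\<close>: the top digit of \<open>p + 1\<close> is the sphere to which \<open>p\<close> belongs, and the digits of \<open>i + 1\<close>
  form the vector \<open>v\<close>.\<close>

definition top_bit :: "nat \<Rightarrow> nat" where
  "top_bit p = (LEAST j. Suc p < 2 ^ j)"

lemma top_bit_less: "Suc p < 2 ^ top_bit p"
  unfolding top_bit_def by (rule LeastI[of _ "Suc p"], rule less_exp)

lemma top_bit_ge_1: "1 \<le> top_bit p"
  using top_bit_less[of p] by (cases "top_bit p") auto

lemma power_top_bit_le: "2 ^ (top_bit p - 1) \<le> Suc p"
proof -
  have "\<not> Suc p < 2 ^ (top_bit p - 1)"
    using top_bit_ge_1[of p] unfolding top_bit_def by (intro not_less_Least) auto
  then show ?thesis by simp
qed

lemma top_bit_le: "Suc p < 2 ^ s \<Longrightarrow> top_bit p \<le> s"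
  unfolding top_bit_def by (rule Least_le)

text \<open>Block \<open>j\<close> has \<open>2 ^ (j - 1)\<close> coordinates, the dimension of the
  \<open>j\<close>-th sphere, and starts at coordinate \<open>2 ^ (j - 1) - 1\<close>.\<close>

lemma top_bit_block:
  assumes "1 \<le> j" "i < 2 ^ (j - 1)"
  shows "top_bit (2 ^ (j - 1) + i - 1) = j"
proof -
  have "(2::nat) ^ j = 2 * 2 ^ (j - 1)"
    using assms(1) by (cases j) auto
  then have p: "Suc (2 ^ (j - 1) + i - 1) < 2 ^ j" "2 ^ (j - 1) \<le> Suc (2 ^ (j - 1) + i - 1)"
    using assms(2) by auto
  have "\<not> top_bit (2 ^ (j - 1) + i - 1) < j"
  proof
    assume "top_bit (2 ^ (j - 1) + i - 1) < j"
    then have "(2::nat) ^ top_bit (2 ^ (j - 1) + i - 1) \<le> 2 ^ (j - 1)"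
      by (intro power_increasing) auto
    then show False using top_bit_less[of "2 ^ (j - 1) + i - 1"] p(2) by linarith
  qed
  then show ?thesis using top_bit_le[OF p(1)] by simp
qed

definition bit_set :: "nat \<Rightarrow> nat \<Rightarrow> nat set" where
  "bit_set s i = {j \<in> {1..s}. bit (Suc i) (j - 1)}"

lemma top_bit_in_bit_set:
  assumes "Suc i < 2 ^ s"
  shows "top_bit i \<in> bit_set s i"
proof -
  have "Suc i < 2 * 2 ^ (top_bit i - 1)"
    using top_bit_less[of i] top_bit_ge_1[of i] by (cases "top_bit i") auto
  then have "Suc i div 2 ^ (top_bit i - 1) = 1"
    using power_top_bit_le[of i] by (intro div_nat_eqI) auto
  then show ?thesis
    using top_bit_ge_1[of i] top_bit_le[OF assms] by (simp add: bit_set_def bit_iff_odd)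
qed

lemma bit_set_le_top_bit:
  assumes "j \<in> bit_set s i"
  shows "j \<le> top_bit i"
proof (rule ccontr)
  assume "\<not> j \<le> top_bit i"
  then have "(2::nat) ^ top_bit i \<le> 2 ^ (j - 1)"
    by (intro power_increasing) auto
  then have "Suc i div 2 ^ (j - 1) = 0"
    by (intro div_less less_le_trans[OF top_bit_less])
  then show False using assms by (simp add: bit_set_def bit_iff_odd)
qed

definition bit_vec :: "nat \<Rightarrow> nat \<Rightarrow> nat \<Rightarrow> bit" where
  "bit_vec s i = (\<lambda>j\<in>{1..s}. of_bool (j \<in> bit_set s i))"

lemma bit_vec_nonzero:
  assumes "Suc i < 2 ^ s"
  shows "bit_vec s i \<in> Z2_vecs s - {Z2_zero s}"
proof -
  have "bit_vec s i (top_bit i) = 1" "Z2_zero s (top_bit i) = 0"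
    using top_bit_in_bit_set[OF assms] by (auto simp: bit_vec_def Z2_zero_def bit_set_def)
  then have "bit_vec s i \<noteq> Z2_zero s" by auto
  then show ?thesis by (auto simp: bit_vec_def Z2_vecs_def)
qed

lemma bit_vec_surj:
  assumes "v \<in> Z2_vecs s - {Z2_zero s}"
  obtains i where "Suc i < 2 ^ s" "v = bit_vec s i"
proof -
  \<comment> \<open>The number \<open>n\<close> with binary digits \<open>v\<close> is positive
    because \<open>v\<close> is nonzero; its label is \<open>n - 1\<close>, as labels are read
    through \<open>i + 1\<close>.\<close>
  define bs where "bs = map (\<lambda>j. v (Suc j) = 1) [0..<s]"
  define n :: nat where "n = horner_sum of_bool 2 bs"
  have n: "bit n k \<longleftrightarrow> k < s \<and> v (Suc k) = 1" for k
    by (auto simp: n_def bs_def bit_horner_sum_bit_iff)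
  have v: "v \<in> extensional {1..s}" using assms by (auto simp: Z2_vecs_def PiE_iff)
  have "n \<noteq> 0"
  proof
    assume "n = 0"
    then have "v (Suc k) = 0" if "k < s" for k using n[of k] that by auto
    then have "v j = Z2_zero s j" if "j \<in> {1..s}" for j
      using that by (cases j) (auto simp: Z2_zero_def)
    then have "v = Z2_zero s"
      using v by (intro extensionalityI[of _ "{1..s}"]) (auto simp: Z2_zero_def)
    then show False using assms by simp
  qed
  moreover have "n < 2 ^ s"
    using horner_sum_bound[of bs] by (simp add: n_def bs_def)
  moreover have "v j = bit_vec s (n - 1) j" if "j \<in> {1..s}" for j
  proof -
    have "bit n (j - 1) \<longleftrightarrow> v j = 1" using n[of "j - 1"] that by auto
    then show ?thesis
      using that \<open>n \<noteq> 0\<close> by (cases "v j") (auto simp: bit_vec_def bit_set_def)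
  qed
  then have "v = bit_vec s (n - 1)"
    using v by (intro extensionalityI[of _ "{1..s}"]) (auto simp: bit_vec_def)
  ultimately show ?thesis using that[of "n - 1"] by simp
qed

section \<open>Wrapping cubes onto hemispheres\<close>

text \<open>The coordinates \<open>n - 1, \<dots>, 2 * n - 2\<close> of \<open>t\<close> form a cube, which is wrapped onto a hemisphere; the
  additional coordinate vanishes exactly on the boundary of the cube, so that it goes to the equator.\<close>

definition hemi :: "nat \<Rightarrow> (nat \<Rightarrow> real) \<Rightarrow> nat \<Rightarrow> real" where
  "hemi n t i = (if i < n then t (n + i - 1) else if i = n then \<Prod>q<n. 1 - (t (n + q - 1))\<^sup>2 else 0)"

definition hemi_norm :: "nat \<Rightarrow> (nat \<Rightarrow> real) \<Rightarrow> real" where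
  "hemi_norm n t = sqrt (\<Sum>i\<le>n. (hemi n t i)\<^sup>2)"

definition param :: "nat \<Rightarrow> (nat \<Rightarrow> real) \<Rightarrow> nat \<Rightarrow> nat \<Rightarrow> real" where
  "param s t = (\<lambda>j\<in>{1..s}. \<lambda>i. hemi (2 ^ (j - 1)) t i / hemi_norm (2 ^ (j - 1)) t)"

text \<open>If all cube coordinates vanish, the additional coordinate is an empty-handed product of
  ones, so the vector is never 0.\<close>

lemma hemi_norm_pos: "0 < hemi_norm n t"
proof -
  have "(\<Sum>i\<le>n. (hemi n t i)\<^sup>2) \<noteq> 0"
  proof
    assume "(\<Sum>i\<le>n. (hemi n t i)\<^sup>2) = 0"
    then have z: "\<And>i. i \<le> n \<Longrightarrow> hemi n t i = 0"
      by (subst (asm) sum_nonneg_eq_0_iff) auto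
    then have "t (n + q - 1) = 0" if "q < n" for q
      using z[of q] that by (simp add: hemi_def)
    then have "hemi n t n = 1" by (simp add: hemi_def)
    then show False using z[of n] by simp
  qed
  then show ?thesis
    unfolding hemi_norm_def real_sqrt_gt_0_iff by (simp add: order_less_le sum_nonneg)
qed

lemma continuous_on_hemi: "continuous_on UNIV (\<lambda>t. hemi n t i)"
  unfolding hemi_def by (cases "i < n"; cases "i = n") (auto intro!: continuous_intros)

lemma continuous_map_param: "continuous_map euclidean (X_space s) (param s)"
  unfolding X_space_def
proof (subst continuous_map_componentwise, intro conjI ballI)
  show "param s ` topspace euclidean \<subseteq> extensional {1..s}"
    by (auto simp: param_def)
  fix j assume j: "j \<in> {1..s}"
  let ?n = "2 ^ (j - 1) :: nat"
  have "continuous_on UNIV (\<lambda>t. hemi ?n t i / hemi_norm ?n t)" for i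
    unfolding hemi_norm_def
    by (intro continuous_intros continuous_on_hemi)
      (use hemi_norm_pos[unfolded hemi_norm_def] in \<open>auto simp: less_le\<close>)
  moreover have "(\<Sum>i\<le>?n. (hemi ?n t i / hemi_norm ?n t)\<^sup>2) = 1" for t
  proof -
    have "(\<Sum>i\<le>?n. (hemi ?n t i)\<^sup>2) = (hemi_norm ?n t)\<^sup>2"
      by (simp add: hemi_norm_def sum_nonneg)
    then show ?thesis
      using hemi_norm_pos[of ?n t] by (simp add: power_divide sum_divide_distrib[symmetric])
  qed
  moreover have "hemi ?n t i / hemi_norm ?n t = 0" if "i > ?n" for t i
    using that by (simp add: hemi_def)
  ultimately show "continuous_map euclidean (nsphere (2 ^ (j - 1))) (\<lambda>t. param s t j)"
    using j unfolding nsphere continuous_map_in_subtopology continuous_map_componentwise_UNIV param_def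
    by auto
qed

text \<open>A block coordinate \<plusminus> 1 makes the additional coordinate 0, so negating the
  block negates the whole vector and keeps its norm.\<close>

lemma param_flip:
  assumes j: "j \<in> {1..s}" and p: "top_bit p = j" "\<bar>t p\<bar> = 1"
    and t': "t' = (\<lambda>q. if top_bit q = j then - t q else t q)"
  shows "param s t' = Fl j (param s t)"
proof -
  have hemi_other: "hemi (2 ^ (k - 1)) t' i = hemi (2 ^ (k - 1)) t i"
    if "k \<in> {1..s}" "k \<noteq> j" for k i
    using that top_bit_block[of k] by (auto simp: hemi_def t' intro!: prod.cong)
  let ?n = "2 ^ (j - 1) :: nat"
  have "p = ?n + (Suc p - ?n) - 1" "Suc p - ?n < ?n"
  proof -
    show "p = ?n + (Suc p - ?n) - 1" using power_top_bit_le[of p] p by simp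
    have "(2::nat) ^ j = 2 * ?n" using j by (cases j) auto
    then show "Suc p - ?n < ?n" using top_bit_less[of p] p by simp
  qed
  then obtain q where q: "q < ?n" "p = ?n + q - 1" by blast
  have "1 - (t p)\<^sup>2 = 0" using p(2) by (simp add: power2_eq_1_iff abs_if split: if_splits)
  then have "(\<Prod>q<?n. 1 - (t (?n + q - 1))\<^sup>2) = 0"
    using q by (intro prod_zero) auto
  moreover have "t' (?n + i - 1) = - t (?n + i - 1)" if "i < ?n" for i
    using top_bit_block[of j i] that j by (simp add: t')
  ultimately have hemi_same: "hemi ?n t' i = - hemi ?n t i" for i
    by (simp add: hemi_def)
  have norm: "hemi_norm (2 ^ (k - 1)) t' = hemi_norm (2 ^ (k - 1)) t" if "k \<in> {1..s}" for k
    using hemi_other[OF that] hemi_same by (cases "k = j") (auto simp: hemi_norm_def)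
  show ?thesis
  proof
    fix k
    show "param s t' k = Fl j (param s t) k"
      using j hemi_other[of k] hemi_same norm[of k]
      by (cases "k \<in> {1..s}"; cases "k = j") (auto simp: param_def Fl_def)
  qed
qed

text \<open>The distance of functions is a series of truncated coordinate distances with weights
  \<open>(1 / 2) ^ n\<close>, and the weights add up to 2.\<close>

lemma dist_fun_le:
  fixes x y :: "'a::countable \<Rightarrow> 'b::metric_space"
  assumes "\<And>i. dist (x i) (y i) \<le> d"
  shows "dist x y \<le> 2 * d"
proof -
  have s: "summable (\<lambda>n. (1 / 2 :: real) ^ n)" by (simp add: summable_geometric_iff)
  have "dist x y \<le> (\<Sum>n. (1 / 2) ^ n * d)"
    unfolding dist_fun_def
  proof (rule suminf_le)
    show "(1 / 2) ^ n * min (dist (x (from_nat n)) (y (from_nat n))) 1 \<le> (1 / 2) ^ n * d" for n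
      using assms[of "from_nat n"] by (intro mult_left_mono) auto
    show "summable (\<lambda>n. (1 / 2) ^ n * min (dist (x (from_nat n)) (y (from_nat n))) 1)"
      by (rule summable_comparison_test'[OF s]) auto
    show "summable (\<lambda>n. (1 / 2) ^ n * d)" using s by (rule summable_mult2)
  qed
  also have "\<dots> = 2 * d"
    using suminf_mult2[OF s, of d] suminf_geometric[of "1 / 2 :: real"] by simp
  finally show ?thesis .
qed

text \<open>Points have infinitely many coordinates here, so this is an instance of Tychonoff's
  theorem.\<close>

lemma compact_cube: "compact {t :: nat \<Rightarrow> real. \<forall>p. \<bar>t p\<bar> \<le> 1}"
proof -
  have "compactin (product_topology (\<lambda>_. euclideanreal) UNIV) (\<Pi>\<^sub>E p\<in>(UNIV::nat set). {- 1..1})"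
    by (subst compactin_PiE) simp
  moreover have "(\<Pi>\<^sub>E p\<in>(UNIV::nat set). {- 1..1}) = {t :: nat \<Rightarrow> real. \<forall>p. \<bar>t p\<bar> \<le> 1}"
    by (auto simp: PiE_UNIV_domain abs_le_iff minus_le_iff)
  ultimately show ?thesis by (simp add: euclidean_product_topology)
qed

section \<open>From alternating simplices to a common zero by compactness\<close>

theorem theorem1p2:
  fixes s :: nat
    and f :: "(nat \<Rightarrow> bit) \<Rightarrow> (nat \<Rightarrow> nat \<Rightarrow> real) \<Rightarrow> real"
  assumes "s \<ge> 1"
    and "\<And>v. v \<in> Z2_vecs s - {Z2_zero s} \<Longrightarrow> continuous_map (X_space s) euclideanreal (f v)"
    and "\<And>v x j. v \<in> Z2_vecs s - {Z2_zero s} \<Longrightarrow> x \<in> topspace (X_space s) \<Longrightarrow> j \<in> {1..s} \<Longrightarrow>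
           f v (Fl j x) = (-1) ^ (of_bit (v j) :: nat) * f v x"
  shows "\<exists>x \<in> topspace (X_space s). \<forall>v \<in> Z2_vecs s - {Z2_zero s}. f v x = 0"
proof (rule ccontr)
  assume no_zero: "\<not> ?thesis"
  \<comment> \<open>This is both the dimension 1 + 2 + ... + \<open>2 ^ (s - 1)\<close> of the
    product and the number of nonzero vectors.\<close>
  define N :: nat where "N = 2 ^ s - 1"
  have N: "i < N \<longleftrightarrow> Suc i < 2 ^ s" for i by (auto simp: N_def)
  define g where "g i t = f (bit_vec s i) (param s t)" for i and t :: "nat \<Rightarrow> real"
  have param_in: "param s t \<in> topspace (X_space s)" for t
    using continuous_map_param[of s] by (auto simp: continuous_map_def)
  have g_cont: "continuous_on UNIV (g i)" if "i < N" for i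
  proof -
    have "continuous_map euclidean euclideanreal (f (bit_vec s i) \<circ> param s)"
      using continuous_map_param assms(2) bit_vec_nonzero that N by (blast intro: continuous_map_compose)
    then show ?thesis by (simp add: g_def[abs_def] o_def)
  qed
  have g_nonzero: "\<exists>i<N. g i t \<noteq> 0" for t
    using no_zero param_in[of t] bit_vec_surj unfolding g_def N by metis
  \<comment> \<open>Without a common zero these open sets cover the cube; \<open>\<epsilon>\<close>
    below is a Lebesgue number of the cover.\<close>
  define \<G> where "\<G> = (\<Union>i<N. {{t. g i t < 0}, {t. 0 < g i t}})"
  have "\<exists>\<epsilon>>0. \<forall>t. (\<forall>p. \<bar>t p\<bar> \<le> 1) \<longrightarrow> (\<exists>G\<in>\<G>. ball t \<epsilon> \<subseteq> G)"
  proof (rule Heine_Borel_lemma[OF compact_cube])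
    show "{t. \<forall>p. \<bar>t p\<bar> \<le> 1} \<subseteq> \<Union> \<G>"
      using g_nonzero by (force simp: \<G>_def neq_iff)
    fix G assume "G \<in> \<G>"
    then obtain i where i: "i < N" "G = {t. g i t < 0} \<or> G = {t. 0 < g i t}"
      by (auto simp: \<G>_def)
    have "open {t. g i t < 0}" "open {t. 0 < g i t}"
      by (intro open_Collect_less continuous_intros g_cont i)+
    then show "open G" using i by auto
  qed (auto intro!: exI)
  then obtain \<epsilon> where \<epsilon>: "0 < \<epsilon>"
    "\<And>t. (\<forall>p. \<bar>t p\<bar> \<le> 1) \<Longrightarrow> \<exists>G\<in>\<G>. ball t \<epsilon> \<subseteq> G"
    by blast
  \<comment> \<open>The mesh \<open>1 / m\<close> bounds coordinate differences within a simplex;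
    \<open>dist_fun_le\<close> costs the factor 2.\<close>
  obtain k :: nat where k: "2 / \<epsilon> < real k" using reals_Archimedean2 by blast
  define m where "m = int k"
  have "0 < real k" using k \<epsilon>(1) by (meson divide_pos_pos less_trans zero_less_numeral)
  then have m: "0 < m" "2 * (1 / real_of_int m) < \<epsilon>"
    using k \<epsilon>(1) by (auto simp: m_def field_simps)
  interpret labelled_grid N m top_bit "bit_set s"
  proof
    show "0 < m" by (fact m)
  qed (use bit_set_le_top_bit top_bit_in_bit_set N in \<open>auto simp: bit_set_def\<close>)
  define pt where "pt x = (\<lambda>p. real_of_int (x p) / real_of_int m)" for x :: "nat \<Rightarrow> int"
  \<comment> \<open>where \<open>g i\<close> vanishes, the label must still be equivariant\<close>
  define S where "S i x = (if g i (pt x) = 0 then model i x else of_bool (g i (pt x) < 0))" for i x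
  have S_flip: "S i (flip j x) = S i x + of_bool (j \<in> bit_set s i)"
    if i: "i < N" and x: "x \<in> bdry j" for i j x
  proof -
    obtain p where p: "p < N" "top_bit p = j" "\<bar>x p\<bar> = m" using x by (auto simp: bdry_def)
    then have j: "j \<in> {1..s}" using top_bit_ge_1[of p] top_bit_le[of p s] N by auto
    have "\<bar>pt x p\<bar> = 1" using p(3) m(1) by (simp add: pt_def flip: of_int_abs)
    then have "param s (pt (flip j x)) = Fl j (param s (pt x))"
      by (intro param_flip[OF j p(2)]) (auto simp: pt_def flip_def)
    then have "g i (pt (flip j x)) = (if j \<in> bit_set s i then - g i (pt x) else g i (pt x))"
      using assms(3)[OF bit_vec_nonzero param_in j, of i "pt x"] i N j
      by (simp add: g_def bit_vec_def)
    then show ?thesis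
      using model_flip[OF i x] by (auto simp: S_def)
  qed
  obtain e \<tau> where e: "(e, \<tau>) \<in> simplices"
    and alt: "\<And>i. i < N \<Longrightarrow> S i (vert e \<tau> i) \<noteq> S i (vert e \<tau> (Suc i))"
    using exists_alternating_simplex[of S, OF S_flip] by blast
  have "\<bar>pt (vert e \<tau> 0) p\<bar> \<le> 1" for p
  proof -
    have "\<bar>vert e \<tau> 0 p\<bar> \<le> m" using vert_bounded e by (auto simp: simplices_def)
    then have "real_of_int \<bar>vert e \<tau> 0 p\<bar> \<le> real_of_int m" by (simp only: of_int_le_iff)
    then show ?thesis using m(1) by (simp add: pt_def)
  qed
  then obtain G where G: "G \<in> \<G>" "ball (pt (vert e \<tau> 0)) \<epsilon> \<subseteq> G" using \<epsilon>(2) by blast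
  have pt_in: "pt (vert e \<tau> a) \<in> G" for a
  proof -
    have "\<bar>vert e \<tau> 0 p - vert e \<tau> a p\<bar> \<le> 1" for p by (simp add: vert_def near_def far_def)
    then have "\<bar>real_of_int (vert e \<tau> 0 p - vert e \<tau> a p)\<bar> \<le> 1" for p
      by (metis of_int_abs of_int_le_1_iff)
    then have "dist (pt (vert e \<tau> 0) p) (pt (vert e \<tau> a) p) \<le> 1 / real_of_int m" for p
      using m(1) by (simp add: pt_def dist_real_def divide_right_mono flip: diff_divide_distrib)
    then have "dist (pt (vert e \<tau> 0)) (pt (vert e \<tau> a)) < \<epsilon>"
      using dist_fun_le m(2) by (meson le_less_trans)
    then show ?thesis using G(2) by auto
  qed
  \<comment> \<open>The whole simplex lies in one set of the cover, so one \<open>g i\<close> is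
    nonzero with constant sign on it, although its label changes along edge
    \<open>i\<close>.\<close>
  obtain i where "i < N" "G = {t. g i t < 0} \<or> G = {t. 0 < g i t}"
    using G(1) by (auto simp: \<G>_def)
  then have "S i (vert e \<tau> i) = S i (vert e \<tau> (Suc i))"
    using pt_in[of i] pt_in[of "Suc i"] by (auto simp: S_def)
  then show False using alt \<open>i < N\<close> by blast
qed

end
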